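(* Let $(\xi_{n,m})_{n,m\in\mathbb{Z}}$ be a strictly stationary real-valued random field on the canonical space $\mathbb{R}^{\mathbb{Z}^2}$, with filtration $\mathcal{F}_{n,m}=\sigma(\xi_{i,j}: i\le n, j\le m)$, and let $X_{n,m}=f(\xi_{i,j}, i\le n, j\le m)$ be the associated stationary random field, with $X_{0,0}$ centered and square integrable. Assume that the filtration is commuting, i.e. for every integrable random variable $X$ and all integers $a,b,u,v$ with $a\ge u$, $E(E(X|\mathcal{F}_{a,b})|\mathcal{F}_{u,v})=E(X|\mathcal{F}_{u,b\wedge v})$ almost surely. Let $S_{n,m}=\sum_{u=1}^n\sum_{v=1}^m X_{u,v}$. Then $(X_{n,m})_{n,m\in\mathbb{Z}}$ admits a martingale approximation if and only if both of the following hold: (i) there is a martingale differences field $(D_{n,m})_{n,m\in\mathbb{Z}}$ such that $$\frac{1}{nm}\sum_{j=1}^{n}\sum_{k=1}^{m}\|\mathcal{P}_{1,1}(S_{j,k})-D_{1,1}\|^{2}\to 0\quad\text{as } n\wedge m\to\infty;$$ (ii) $$\frac{1}{nm}\|E_{0,m}(S_{n,m})\|^{2}\to 0\quad\text{and}\quad \frac{1}{nm}\|E_{n,0}(S_{n,m})\|^{2}\to 0\quad\text{as } n\wedge m\to\infty.$$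
   Context: Notation: $a\wedge b=\min(a,b)$; $\|\cdot\|$ is the $L^2$ norm; a limit as $n\wedge m\to\infty$ is a limit as $\min(n,m)\to\infty$ with $n,m$ otherwise unrestricted. Setting: $(\xi_{\mathbf u})_{\mathbf u\in\mathbb{Z}^2}$ is a strictly stationary real-valued random field realized as the coordinate maps on $\Omega=\mathbb{R}^{\mathbb{Z}^2}$, with the $\sigma$-field generated by cylinders and a shift-invariant probability measure $P$. For a measurable function $g$, the notation $Y_{n,m}=g(\xi_{i,j}, i\le n, j\le m)$ means $Y_{n,m}=g\big((\xi_{n+a,m+b})_{a\le 0,b\le 0}\big)$, the same $g$ being used for all $(n,m)$, so that $(Y_{n,m})$ is obtained from $Y_{0,0}$ by shifting: $Y_{n,m}=Y_{0,0}\circ T^nS^m$, where $T((x_{u,v}))=(x_{u+1,v})$ and $S((x_{u,v}))=(x_{u,v+1})$. The field is $X_{n,m}=f(\xi_{i,j}, i\le n, j\le m)$ with $f$ measurable, $E(X_{0,0})=0$, $E(X_{0,0}^2)<\infty$. Write $E_{a,b}(X)=E(X|\mathcal{F}_{a,b})$. The projection operator is $$\mathcal{P}_{u,v}(X)=E_{u,v}(X)-E_{u,v-1}(X)-E_{u-1,v}(X)+E_{u-1,v-1}(X).$$ Martingale differences field: a field $D_{n,m}=d(\xi_{i,j}, i\le n, j\le m)$, with $d$ a measurable function and $D_{n,m}$ integrable, such that $E_{a,b}(D_{n,m})=0$ whenever $a<n$ or $b<m$. Martingale approximation: $(X_{n,m})$ admits a martingale approximation if there is a martingale differences field $(D_{n,m})$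 such that, with $M_{n,m}=\sum_{u=1}^n\sum_{v=1}^m D_{u,v}$, $\lim_{n\wedge m\to\infty}\frac{1}{nm}\|S_{n,m}-M_{n,m}\|^2=0$. *)

theory Defs
  imports "HOL-Probability.Probability"
begin

type_synonym omega = "int \<times> int \<Rightarrow> real"

text \<open>The canonical space: all real configurations on the lattice, with the
  \<open>\<sigma>\<close>-field generated by cylinders.\<close>

definition canonical_space :: "omega measure" where
  "canonical_space = (\<Pi>\<^sub>M u\<in>UNIV. borel)"

definition shift_T :: "omega \<Rightarrow> omega" where
  "shift_T \<omega> = (\<lambda>(u, v). \<omega> (u + 1, v))"

definition shift_S :: "omega \<Rightarrow> omega" where
  "shift_S \<omega> = (\<lambda>(u, v). \<omega> (u, v + 1))"

text \<open>A probability law on the canonical space under which the coordinate field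
  \<open>\<xi>\<^sub>u(\<omega>) = \<omega> u\<close> is strictly stationary. Both shifts are invertible, so
  invariance under them is invariance under all translations of the lattice.\<close>

definition stationary_law :: "omega measure \<Rightarrow> bool" where
  "stationary_law P \<longleftrightarrow>
     prob_space P \<and> sets P = sets canonical_space \<and>
     distr P P shift_T = P \<and> distr P P shift_S = P"

definition filt :: "int \<Rightarrow> int \<Rightarrow> omega measure" where
  "filt n m = sigma UNIV {(\<lambda>\<omega>. \<omega> (i, j)) -` A | i j A. i \<le> n \<and> j \<le> m \<and> A \<in> sets borel}"

lemma subalgebra_filt:
  assumes "stationary_law P"
  shows "subalgebra P (filt n m)"
proof -
  have sets: "sets P = sets canonical_space"
    using assms by (simp add: stationary_law_def)
  have space: "space P = UNIV"
    using sets_eq_imp_space_eq[OF sets] by (simp add: canonical_space_def space_PiM)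
  have "(\<lambda>\<omega>. \<omega> (i, j)) -` A \<in> sets P" if "A \<in> sets borel" for i j :: int and A :: "real set"
  proof -
    have "(\<lambda>\<omega>. \<omega> (i, j)) \<in> measurable canonical_space (borel :: real measure)"
      unfolding canonical_space_def by measurable
    from measurable_sets[OF this that] show ?thesis
      by (simp add: sets canonical_space_def space_PiM)
  qed
  then have "sigma_sets (space P)
      {(\<lambda>\<omega>. \<omega> (i, j)) -` A | i j A. i \<le> n \<and> j \<le> m \<and> A \<in> sets borel} \<subseteq> sets P"
    by (intro sets.sigma_sets_subset) auto
  then show ?thesis
    by (simp add: subalgebra_def filt_def space)
qed

abbreviation E_filt :: "omega measure \<Rightarrow> int \<Rightarrow> int \<Rightarrow> (omega \<Rightarrow> real) \<Rightarrow> omega \<Rightarrow> real" where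
  "E_filt P a b X \<equiv> real_cond_exp P (filt a b) X"

definition commuting_filt :: "omega measure \<Rightarrow> bool" where
  "commuting_filt P \<longleftrightarrow>
     (\<forall>X a b u v. integrable P X \<and> a \<ge> u \<longrightarrow>
        (AE \<omega> in P. E_filt P u v (E_filt P a b X) \<omega> = E_filt P u (min b v) X \<omega>))"

definition proj_op :: "omega measure \<Rightarrow> int \<Rightarrow> int \<Rightarrow> (omega \<Rightarrow> real) \<Rightarrow> omega \<Rightarrow> real" where
  "proj_op P u v X = (\<lambda>\<omega>. E_filt P u v X \<omega> - E_filt P u (v - 1) X \<omega>
     - E_filt P (u - 1) v X \<omega> + E_filt P (u - 1) (v - 1) X \<omega>)"

text \<open>A functional of the past is a measurable function of configurations indexed by the
  quadrant \<open>a \<le> 0, b \<le> 0\<close>; \<open>field_of g\<close> is the field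
  \<open>g(\<xi>\<^sub>i\<^sub>,\<^sub>j, i \<le> n, j \<le> m)\<close>, with the same \<open>g\<close> at every site.\<close>

definition quadrant :: "(int \<times> int) set" where
  "quadrant = {..0} \<times> {..0}"

definition past_functionals :: "(omega \<Rightarrow> real) set" where
  "past_functionals = borel_measurable (\<Pi>\<^sub>M u\<in>quadrant. borel)"

definition field_of :: "(omega \<Rightarrow> real) \<Rightarrow> int \<Rightarrow> int \<Rightarrow> omega \<Rightarrow> real" where
  "field_of g n m \<omega> = g (restrict (\<lambda>(a, b). \<omega> (n + a, m + b)) quadrant)"

definition martingale_differences_field ::
  "omega measure \<Rightarrow> (int \<Rightarrow> int \<Rightarrow> omega \<Rightarrow> real) \<Rightarrow> bool" where
  "martingale_differences_field P D \<longleftrightarrow>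
     (\<exists>d\<in>past_functionals. D = field_of d) \<and>
     (\<forall>n m. integrable P (D n m)) \<and>
     (\<forall>n m a b. a < n \<or> b < m \<longrightarrow> (AE \<omega> in P. E_filt P a b (D n m) \<omega> = 0))"

definition partial_sum ::
  "(int \<Rightarrow> int \<Rightarrow> omega \<Rightarrow> real) \<Rightarrow> nat \<Rightarrow> nat \<Rightarrow> omega \<Rightarrow> real" where
  "partial_sum X n m \<omega> = (\<Sum>u = 1..int n. \<Sum>v = 1..int m. X u v \<omega>)"

text \<open>The squared \<open>L\<^sup>2\<close> norm takes values in the extended nonnegative reals, so that it is
  infinite on functions that are not square integrable (a martingale differences field is
  only required to be integrable); the Bochner integral would return 0 there.\<close>

definition L2_norm_sq :: "omega measure \<Rightarrow> (omega \<Rightarrow> real) \<Rightarrow> ennreal" where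
  "L2_norm_sq P X = (\<integral>\<^sup>+ \<omega>. ennreal ((X \<omega>)\<^sup>2) \<partial>P)"

definition min_to_infinity :: "(nat \<times> nat) filter" where
  "min_to_infinity = filtercomap (\<lambda>(n, m). min n m) at_top"

definition admits_martingale_approximation ::
  "omega measure \<Rightarrow> (int \<Rightarrow> int \<Rightarrow> omega \<Rightarrow> real) \<Rightarrow> bool" where
  "admits_martingale_approximation P X \<longleftrightarrow>
     (\<exists>D. martingale_differences_field P D \<and>
        ((\<lambda>(n, m). ennreal (1 / (real n * real m)) *
            L2_norm_sq P (\<lambda>\<omega>. partial_sum X n m \<omega> - partial_sum D n m \<omega>))
          \<longlongrightarrow> 0) min_to_infinity)"

end

(* Put R = E_{0,m}(S) + E_{n,0}(S) - E_{0,0}(S) for S = S_{n,m}. Summing the projections telescopes: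
   S is the sum of P_{u,v}(S) over 1 <= u <= n, 1 <= v <= m, plus R. Hence S - M is a sum of the
   increments P_{u,v}(S) - D_{u,v}, orthogonal to each other and to R because the filtration
   commutes. By adaptedness and stationarity the norm of the (u,v) increment is that of
   P_{1,1}(S_{n-u+1,m-v+1}) - D_{1,1}, so that
     ||S - M||^2 = sum_{j<=n, k<=m} ||P_{1,1}(S_{j,k}) - D_{1,1}||^2 + ||R||^2.
   Moreover ||R||^2 = ||E_{0,m}(S)||^2 + ||E_{n,0}(S)||^2 - ||E_{0,0}(S)||^2 lies between the maximum
   and the sum of the first two terms, so the equivalence holds with the same D on both sides.
   D is only assumed integrable, but finiteness of a single norm on either side makes D_{1,1}
   square integrable, since E_{1,1}(M) = D_{1,1}. *)

theory Submission
  imports Defs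
begin

section \<open>Square-integrable functions, orthogonal sums and the extended norm\<close>

definition square_integrable :: "'a measure \<Rightarrow> ('a \<Rightarrow> real) \<Rightarrow> bool" where
  "square_integrable M f \<longleftrightarrow> f \<in> borel_measurable M \<and> integrable M (\<lambda>x. (f x)\<^sup>2)"

lemma square_integrable_measurable [measurable_dest]:
  "square_integrable M f \<Longrightarrow> f \<in> borel_measurable M"
  by (simp add: square_integrable_def)

lemma square_integrable_mult:
  assumes "square_integrable M f" "square_integrable M g"
  shows "integrable M (\<lambda>x. f x * g x)"
proof (rule Bochner_Integration.integrable_bound)
  show "integrable M (\<lambda>x. (f x)\<^sup>2 + (g x)\<^sup>2)"
    using assms by (auto simp: square_integrable_def)
  show "(\<lambda>x. f x * g x) \<in> borel_measurable M"
    using assms by (auto simp: square_integrable_def)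
  have "\<bar>a * b\<bar> \<le> a\<^sup>2 + b\<^sup>2" for a b :: real
    using sum_squares_bound[of "\<bar>a\<bar>" "\<bar>b\<bar>"] zero_le_mult_iff[of "\<bar>a\<bar>" "\<bar>b\<bar>"]
    unfolding abs_mult power2_abs by linarith
  then show "AE x in M. norm (f x * g x) \<le> norm ((f x)\<^sup>2 + (g x)\<^sup>2)"
    by simp
qed

lemma square_integrable_add:
  assumes "square_integrable M f" "square_integrable M g"
  shows "square_integrable M (\<lambda>x. f x + g x)"
  using assms square_integrable_mult[OF assms]
  by (auto simp: square_integrable_def power2_sum mult.assoc)

lemma square_integrable_diff:
  assumes "square_integrable M f" "square_integrable M g"
  shows "square_integrable M (\<lambda>x. f x - g x)"
  using assms square_integrable_mult[OF assms]
  by (auto simp: square_integrable_def power2_diff mult.assoc)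

lemma square_integrable_sum:
  assumes "\<And>i. i \<in> I \<Longrightarrow> square_integrable M (f i)"
  shows "square_integrable M (\<lambda>x. \<Sum>i\<in>I. f i x)"
  using assms
proof (induction I rule: infinite_finite_induct)
  case (insert i I)
  then show ?case by (simp add: square_integrable_add)
qed (auto simp: square_integrable_def)

lemma integral_square_add_orthogonal:
  assumes "square_integrable M f" "square_integrable M g" "(\<integral>x. f x * g x \<partial>M) = 0"
  shows "(\<integral>x. (f x + g x)\<^sup>2 \<partial>M) = (\<integral>x. (f x)\<^sup>2 \<partial>M) + (\<integral>x. (g x)\<^sup>2 \<partial>M)"
  using assms square_integrable_mult[OF assms(1,2)]
  by (simp add: square_integrable_def power2_sum mult.assoc)

lemma integral_square_sum_orthogonal:
  assumes "finite I" "\<And>i. i \<in> I \<Longrightarrow> square_integrable M (f i)"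
    and "\<And>i j. i \<in> I \<Longrightarrow> j \<in> I \<Longrightarrow> i \<noteq> j \<Longrightarrow> (\<integral>x. f i x * f j x \<partial>M) = 0"
  shows "(\<integral>x. (\<Sum>i\<in>I. f i x)\<^sup>2 \<partial>M) = (\<Sum>i\<in>I. \<integral>x. (f i x)\<^sup>2 \<partial>M)"
  using assms
proof (induction I)
  case (insert i I)
  have "(\<integral>x. f i x * (\<Sum>j\<in>I. f j x) \<partial>M) = (\<Sum>j\<in>I. \<integral>x. f i x * f j x \<partial>M)"
    unfolding sum_distrib_left
    by (intro Bochner_Integration.integral_sum square_integrable_mult) (auto intro: insert.prems)
  also have "\<dots> = 0"
    using insert.hyps by (intro sum.neutral ballI insert.prems) auto
  finally have "(\<integral>x. (f i x + (\<Sum>j\<in>I. f j x))\<^sup>2 \<partial>M)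
      = (\<integral>x. (f i x)\<^sup>2 \<partial>M) + (\<integral>x. (\<Sum>j\<in>I. f j x)\<^sup>2 \<partial>M)"
    by (intro integral_square_add_orthogonal square_integrable_sum) (auto intro: insert.prems)
  then show ?case
    using insert by simp
qed simp

lemma L2_norm_sq_eq_integral:
  assumes "square_integrable P X"
  shows "L2_norm_sq P X = ennreal (\<integral>\<omega>. (X \<omega>)\<^sup>2 \<partial>P)"
  using assms by (simp add: L2_norm_sq_def square_integrable_def nn_integral_eq_integral)

text \<open>Finiteness of the extended norm is all that a limit provides about \<open>D\<close>;
  this turns it into integrability.\<close>

lemma square_integrable_iff_L2_norm_sq:
  "square_integrable P X \<longleftrightarrow> X \<in> borel_measurable P \<and> L2_norm_sq P X < \<infinity>"
  by (auto simp: L2_norm_sq_def square_integrable_def integrable_iff_bounded)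

lemma L2_norm_sq_cong_AE:
  assumes "AE \<omega> in P. X \<omega> = Y \<omega>"
  shows "L2_norm_sq P X = L2_norm_sq P Y"
  unfolding L2_norm_sq_def using assms by (intro nn_integral_cong_AE) auto

section \<open>Conditional expectation under a measure-preserving map\<close>

text \<open>Every set of \<open>G\<close> is the preimage under \<open>T\<close> of a set of
  \<open>F\<close>. Invariance carries integrals over the one to integrals over the other, so the
  right-hand side has the defining property of the conditional expectation given
  \<open>G\<close>.\<close>

lemma (in prob_space) real_cond_exp_vimage_algebra:
  assumes T: "T \<in> measurable M M" "distr M M T = M"
    and F: "subalgebra M F" and G: "G = vimage_algebra (space M) T F" and f: "integrable M f"
  shows "AE x in M. real_cond_exp M G (\<lambda>x. f (T x)) x = real_cond_exp M F f (T x)"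
proof -
  have TF: "T \<in> space M \<rightarrow> space F"
    using T(1) F by (auto simp: measurable_def subalgebra_def)
  have sets_G: "sets G = {T -` A \<inter> space M |A. A \<in> sets F}"
    unfolding G using TF by (rule sets_vimage_algebra2)
  have sub_G: "subalgebra M G"
    using F T(1) by (auto simp: subalgebra_def sets_G measurable_sets) (auto simp: G)
  interpret F: finite_measure_subalgebra M F by standard (rule F)
  interpret G: finite_measure_subalgebra M G by standard (rule sub_G)
  have intT: "integrable M (\<lambda>x. g (T x))" if "integrable M g" for g :: "'a \<Rightarrow> real"
    using that T by (intro integrable_distr[of T M M]) auto
  have intgT: "(\<integral>x. g (T x) \<partial>M) = (\<integral>x. g x \<partial>M)" if "g \<in> borel_measurable M" for g :: "'a \<Rightarrow> real"
    using integral_distr[of T M M g] T that by simp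
  have mF: "real_cond_exp M F f \<in> borel_measurable M"
    by simp
  show ?thesis
  proof (rule G.real_cond_exp_charact)
    fix A assume "A \<in> sets G"
    then obtain B where B: "B \<in> sets F" "A = T -` B \<inter> space M"
      using sets_G by auto
    have BM[measurable]: "B \<in> sets M" using B F by (auto simp: subalgebra_def)
    \<comment> \<open>Change of variables: the indicator of \<open>A\<close> at \<open>x\<close> is
      the indicator of \<open>B\<close> at \<open>T x\<close>.\<close>
    have *: "(\<integral>x\<in>A. g (T x) \<partial>M) = (\<integral>x\<in>B. g x \<partial>M)" if [measurable]: "g \<in> borel_measurable M"
      for g :: "'a \<Rightarrow> real"
    proof -
      have "(\<integral>x\<in>A. g (T x) \<partial>M) = (\<integral>x. indicator B (T x) *\<^sub>R g (T x) \<partial>M)"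
        unfolding set_lebesgue_integral_def
        by (intro Bochner_Integration.integral_cong) (auto simp: B indicator_def)
      also have "\<dots> = (\<integral>x. indicator B x *\<^sub>R g x \<partial>M)"
        by (rule intgT) measurable
      finally show ?thesis by (simp add: set_lebesgue_integral_def)
    qed
    show "(\<integral>x\<in>A. f (T x) \<partial>M) = (\<integral>x\<in>A. real_cond_exp M F f (T x) \<partial>M)"
      using *[of f] *[OF mF] F.real_cond_exp_intA[OF f B(1)] f by simp
  next
    show "integrable M (\<lambda>x. f (T x))" by (rule intT[OF f])
    show "integrable M (\<lambda>x. real_cond_exp M F f (T x))"
      by (intro intT F.real_cond_exp_int f)
    have "T \<in> measurable G F"
      unfolding G by (rule measurable_vimage_algebra1[OF TF])
    then show "(\<lambda>x. real_cond_exp M F f (T x)) \<in> borel_measurable G"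
      by measurable
  qed
qed

section \<open>Lattice translations and the quadrant filtration\<close>

definition translation :: "int \<Rightarrow> int \<Rightarrow> omega \<Rightarrow> omega" where
  "translation p q \<omega> = (\<lambda>(u, v). \<omega> (u + p, v + q))"

lemma field_of_translation:
  "field_of g n m (translation p q \<omega>) = field_of g (n + p) (m + q) \<omega>"
  unfolding field_of_def translation_def
  by (rule arg_cong[where f = g]) (auto simp: restrict_def algebra_simps)

lemma space_filt [simp]: "space (filt a b) = UNIV"
  by (simp add: filt_def)

lemma sets_filt:
  "sets (filt a b) =
     sigma_sets UNIV {(\<lambda>\<omega>. \<omega> (i, j)) -` A | i j A. i \<le> a \<and> j \<le> b \<and> A \<in> sets borel}"
  by (simp add: filt_def)

lemma sets_filt_mono: "a \<le> c \<Longrightarrow> b \<le> d \<Longrightarrow> sets (filt a b) \<subseteq> sets (filt c d)"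
  unfolding sets_filt by (rule sigma_sets_mono') fastforce

lemma borel_measurable_filt_mono:
  "f \<in> borel_measurable (filt a b) \<Longrightarrow> a \<le> c \<Longrightarrow> b \<le> d \<Longrightarrow> f \<in> borel_measurable (filt c d)"
  using sets_filt_mono[of a c b d] by (auto simp: measurable_def)

text \<open>The generators correspond: pulling back an event about coordinate \<open>(i, j)\<close>
  gives the same event about \<open>(i + p, j + q)\<close>, and subtracting \<open>(p, q)\<close>
  inverts this.\<close>

lemma filt_translation: "filt (a + p) (b + q) = vimage_algebra UNIV (translation p q) (filt a b)"
proof -
  have "{translation p q -` A \<inter> UNIV | A. A \<in>
      {(\<lambda>\<omega>. \<omega> (i, j)) -` A | i j A. i \<le> a \<and> j \<le> b \<and> A \<in> sets borel}}
    = {(\<lambda>\<omega>. \<omega> (i, j)) -` A | i j A. i \<le> a + p \<and> j \<le> b + q \<and> A \<in> sets (borel :: real measure)}"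
    (is "?L = ?R")
  proof (intro equalityI subsetI)
    fix B assume "B \<in> ?L"
    then obtain i j A where "i \<le> a" "j \<le> b" "A \<in> sets (borel :: real measure)"
      "B = (\<lambda>\<omega>. \<omega> (i + p, j + q)) -` A"
      by (auto simp: translation_def vimage_def)
    then show "B \<in> ?R"
      by (intro CollectI exI[of _ "i + p"] exI[of _ "j + q"] exI[of _ A]) auto
  next
    fix B assume "B \<in> ?R"
    then obtain i j A where *: "i \<le> a + p" "j \<le> b + q" "A \<in> sets (borel :: real measure)"
      "B = (\<lambda>\<omega>. \<omega> (i, j)) -` A"
      by blast
    then have "B = translation p q -` ((\<lambda>\<omega>. \<omega> (i - p, j - q)) -` A)"
      by (auto simp: translation_def vimage_def)
    with * show "B \<in> ?L"
      by (intro CollectI exI[of _ "(\<lambda>\<omega>. \<omega> (i - p, j - q)) -` A"] conjI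
          exI[of _ "i - p"] exI[of _ "j - q"] exI[of _ A]) auto
  qed
  then show ?thesis
    unfolding filt_def by (subst vimage_algebra_sigma) auto
qed

lemma coordinate_measurable_filt:
  "i \<le> a \<Longrightarrow> j \<le> b \<Longrightarrow> (\<lambda>\<omega>. \<omega> (i, j)) \<in> borel_measurable (filt a b)"
  by (rule measurableI) (auto simp: sets_filt intro!: sigma_sets.Basic)

lemma field_of_measurable_filt:
  assumes "g \<in> past_functionals"
  shows "field_of g n m \<in> borel_measurable (filt n m)"
proof -
  have "(\<lambda>\<omega>. restrict (\<lambda>(a, b). \<omega> (n + a, m + b)) quadrant)
      \<in> measurable (filt n m) (\<Pi>\<^sub>M u\<in>quadrant. borel)"
    by (rule measurable_restrict) (auto simp: quadrant_def intro!: coordinate_measurable_filt)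
  from measurable_compose[OF this] show ?thesis
    using assms unfolding past_functionals_def field_of_def[abs_def] by blast
qed

section \<open>Sums over rectangles and telescoping\<close>

lemma partial_sum_eq_sum_Times:
  "partial_sum X n m \<omega> = (\<Sum>(u, v)\<in>{1..int n} \<times> {1..int m}. X u v \<omega>)"
  by (simp add: partial_sum_def sum.cartesian_product)

lemma sum_telescope_int:
  fixes g :: "int \<Rightarrow> real"
  shows "(\<Sum>u = 1..int n. g u - g (u - 1)) = g (int n) - g 0"
proof (induction n)
  case (Suc n)
  have "{1..int (Suc n)} = insert (int (Suc n)) {1..int n}" by auto
  with Suc show ?case by simp
qed simp

text \<open>At fixed \<open>\<omega>\<close>, \<open>proj_op\<close> is the mixed second difference
  of the array of conditional expectations, so the sum over a rectangle leaves its four corners. The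
  identity is pointwise because the same versions occur on both sides.\<close>

lemma sum_proj_op:
  "(\<Sum>u = 1..int n. \<Sum>v = 1..int m. proj_op P u v X \<omega>)
     = E_filt P (int n) (int m) X \<omega> - E_filt P (int n) 0 X \<omega>
       - E_filt P 0 (int m) X \<omega> + E_filt P 0 0 X \<omega>"
proof -
  \<comment> \<open>First difference in \<open>u\<close>: the projection is its difference in
    \<open>v\<close>, so the sum telescopes first in \<open>v\<close>, then in
    \<open>u\<close>.\<close>
  let ?g = "\<lambda>u v. E_filt P u v X \<omega> - E_filt P (u - 1) v X \<omega>"
  have "proj_op P u v X \<omega> = ?g u v - ?g u (v - 1)" for u v
    by (simp add: proj_op_def)
  then have "(\<Sum>v = 1..int m. proj_op P u v X \<omega>) = ?g u (int m) - ?g u 0" for u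
    using sum_telescope_int[of "?g u" m] by (simp only:)
  then have "(\<Sum>u = 1..int n. \<Sum>v = 1..int m. proj_op P u v X \<omega>)
      = (\<Sum>u = 1..int n. ?g u (int m)) - (\<Sum>u = 1..int n. ?g u 0)"
    by (simp only: sum_subtractf)
  then show ?thesis
    using sum_telescope_int[of "\<lambda>u. E_filt P u (int m) X \<omega>"]
      sum_telescope_int[of "\<lambda>u. E_filt P u 0 X \<omega>"] by simp
qed

section \<open>Stationarity, and projections in L2\<close>

locale stationary_law_space =
  fixes P :: "omega measure"
  assumes law: "stationary_law P"
begin

sublocale prob_space P
  using law by (simp add: stationary_law_def)

lemma sets_P: "sets P = sets (\<Pi>\<^sub>M u\<in>UNIV. borel)"
  using law by (simp add: stationary_law_def canonical_space_def)

lemma space_P [simp]: "space P = UNIV"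
  using sets_eq_imp_space_eq[OF sets_P] by (simp add: space_PiM)

lemma sub_filt: "subalgebra P (filt a b)"
  by (rule subalgebra_filt[OF law])

sublocale filt: finite_measure_subalgebra P "filt a b" for a b
  by standard (rule sub_filt)

lemma borel_measurable_P: "f \<in> borel_measurable (filt a b) \<Longrightarrow> f \<in> borel_measurable P"
  by (rule measurable_from_subalg[OF sub_filt])

lemma borel_measurable_E_filt:
  "a \<le> c \<Longrightarrow> b \<le> d \<Longrightarrow> E_filt P a b X \<in> borel_measurable (filt c d)"
  by (rule borel_measurable_filt_mono[OF borel_measurable_cond_exp])

lemma translation_measurable: "translation p q \<in> measurable P P"
proof -
  have "translation p q \<in> measurable (\<Pi>\<^sub>M u\<in>UNIV. borel) (\<Pi>\<^sub>M u\<in>UNIV. borel)"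
    unfolding translation_def[abs_def] case_prod_beta
    by (rule measurable_PiM_single') (auto simp: space_PiM)
  then show ?thesis
    using measurable_cong_sets[OF sets_P sets_P] by blast
qed

text \<open>Built by composing the two unit shifts. Nonnegative offsets suffice: the site
  \<open>(u, v)\<close> with \<open>u, v\<close> at least 1 is always brought back to
  \<open>(1, 1)\<close> by the offset \<open>(u - 1, v - 1)\<close>.\<close>

lemma distr_translation: "distr P P (translation (int p) (int q)) = P"
proof -
  have T: "shift_T = translation 1 0" and S: "shift_S = translation 0 1"
    by (auto simp: fun_eq_iff shift_T_def shift_S_def translation_def)
  have comp: "translation p q \<circ> translation r s = translation (p + r) (q + s)" for p q r s
    by (auto simp: fun_eq_iff translation_def algebra_simps)
  have step: "distr P P (translation (p + r) (q + s)) = P"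
    if "distr P P (translation p q) = P" "distr P P (translation r s) = P" for p q r s
    by (metis comp that distr_distr[OF translation_measurable translation_measurable])
  have "translation 0 0 = (\<lambda>\<omega>. \<omega>)"
    by (auto simp: fun_eq_iff translation_def)
  then have *: "distr P P (translation 0 0) = P" by (simp add: distr_id)
  have "distr P P (translation (int p) 0) = P" for p
  proof (induction p)
    case (Suc p)
    then show ?case using step[of 1 0 "int p" 0] law by (simp add: T stationary_law_def)
  qed (simp add: *)
  moreover have "distr P P (translation 0 (int q)) = P" for q
  proof (induction q)
    case (Suc p)
    then show ?case using step[of 0 1 0 "int p"] law by (simp add: S stationary_law_def)
  qed (simp add: *)
  ultimately show ?thesis using step[of "int p" 0 0 "int q"] by simp
qed

lemma L2_norm_sq_translation:
  assumes [measurable]: "X \<in> borel_measurable P"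
  shows "L2_norm_sq P (\<lambda>\<omega>. X (translation (int p) (int q) \<omega>)) = L2_norm_sq P X"
proof -
  have "L2_norm_sq P X = L2_norm_sq (distr P P (translation (int p) (int q))) X"
    by (simp add: distr_translation)
  also have "\<dots> = L2_norm_sq P (\<lambda>\<omega>. X (translation (int p) (int q) \<omega>))"
    unfolding L2_norm_sq_def by (rule nn_integral_distr[OF translation_measurable]) simp
  finally show ?thesis ..
qed

lemma E_filt_translation:
  assumes "integrable P X"
  shows "AE \<omega> in P. E_filt P (a + int p) (b + int q) (\<lambda>\<omega>. X (translation (int p) (int q) \<omega>)) \<omega>
    = E_filt P a b X (translation (int p) (int q) \<omega>)"
  by (rule real_cond_exp_vimage_algebra[OF translation_measurable distr_translation sub_filt _ assms])
    (simp only: filt_translation space_P)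

lemma square_integrable_imp_integrable_P: "square_integrable P X \<Longrightarrow> integrable P X"
  by (simp add: square_integrable_def square_integrable_imp_integrable)

text \<open>Conditional Jensen inequality for the square.\<close>

lemma square_integrable_E_filt:
  assumes "square_integrable P X"
  shows "square_integrable P (E_filt P a b X)"
proof -
  have "convex_on UNIV (\<lambda>x::real. x\<^sup>2)"
    by (rule convex_power2)
  then have "integrable P (\<lambda>\<omega>. (E_filt P a b X \<omega>)\<^sup>2)"
    using assms square_integrable_imp_integrable_P[OF assms]
    by (intro filt.integrable_convex_cond_exp[where I = UNIV]) (auto simp: square_integrable_def)
  then show ?thesis
    by (simp add: square_integrable_def)
qed

lemma square_integrable_proj_op:
  assumes "square_integrable P X"
  shows "square_integrable P (proj_op P u v X)"
  unfolding proj_op_def using assms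
  by (intro square_integrable_add square_integrable_diff square_integrable_E_filt)

text \<open>Conditional expectation as orthogonal projection in L2; the orthogonality relations
  below all come from it.\<close>

lemma integral_mult_E_filt:
  assumes "square_integrable P X" "square_integrable P Y" "Y \<in> borel_measurable (filt a b)"
  shows "(\<integral>\<omega>. Y \<omega> * E_filt P a b X \<omega> \<partial>P) = (\<integral>\<omega>. Y \<omega> * X \<omega> \<partial>P)"
  using assms by (intro filt.real_cond_exp_intg square_integrable_mult) (auto simp: square_integrable_def)

lemma proj_op_sum:
  assumes "\<And>i. integrable P (X i)"
  shows "AE \<omega> in P. proj_op P u v (\<lambda>\<omega>. \<Sum>i\<in>I. X i \<omega>) \<omega> = (\<Sum>i\<in>I. proj_op P u v (X i) \<omega>)"
  using filt.real_cond_exp_sum[of X u v I, OF assms]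
    filt.real_cond_exp_sum[of X "u - 1" v I, OF assms]
    filt.real_cond_exp_sum[of X u "v - 1" I, OF assms]
    filt.real_cond_exp_sum[of X "u - 1" "v - 1" I, OF assms]
  by eventually_elim (simp add: proj_op_def sum.distrib sum_subtractf)

lemma proj_op_translation:
  assumes "integrable P X"
  shows "AE \<omega> in P. proj_op P (u + int p) (v + int q) (\<lambda>\<omega>. X (translation (int p) (int q) \<omega>)) \<omega>
    = proj_op P u v X (translation (int p) (int q) \<omega>)"
  using E_filt_translation[OF assms, of u p v q] E_filt_translation[OF assms, of "u - 1" p v q]
    E_filt_translation[OF assms, of u p "v - 1" q] E_filt_translation[OF assms, of "u - 1" p "v - 1" q]
  by eventually_elim (simp add: proj_op_def algebra_simps)

section \<open>Increments and their orthogonality\<close>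

text \<open>A common notion for the projections at a site and the martingale difference at that
  site. Working at a single site lets their difference qualify as well.\<close>

definition increment :: "int \<Rightarrow> int \<Rightarrow> (omega \<Rightarrow> real) \<Rightarrow> bool" where
  "increment u v Z \<longleftrightarrow> square_integrable P Z \<and> Z \<in> borel_measurable (filt u v) \<and>
     (\<forall>a b. a < u \<or> b < v \<longrightarrow> (AE \<omega> in P. E_filt P a b Z \<omega> = 0))"

lemma increment_diff:
  assumes "increment u v Y" "increment u v Z"
  shows "increment u v (\<lambda>\<omega>. Y \<omega> - Z \<omega>)"
proof -
  have "AE \<omega> in P. E_filt P a b (\<lambda>\<omega>. Y \<omega> - Z \<omega>) \<omega> = 0" if "a < u \<or> b < v" for a b
  proof -
    have "AE \<omega> in P. E_filt P a b Y \<omega> = 0" "AE \<omega> in P. E_filt P a b Z \<omega> = 0"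
      using assms that by (auto simp: increment_def)
    moreover have "AE \<omega> in P. E_filt P a b (\<lambda>\<omega>. Y \<omega> - Z \<omega>) \<omega> = E_filt P a b Y \<omega> - E_filt P a b Z \<omega>"
      using assms by (intro filt.real_cond_exp_diff square_integrable_imp_integrable_P)
        (auto simp: increment_def)
    ultimately show ?thesis by eventually_elim simp
  qed
  then show ?thesis
    using assms by (auto simp: increment_def square_integrable_diff)
qed

lemma increment_orthogonal:
  assumes Z: "increment u v Z" and Y: "square_integrable P Y" "Y \<in> borel_measurable (filt a b)"
    and ab: "a < u \<or> b < v"
  shows "(\<integral>\<omega>. Y \<omega> * Z \<omega> \<partial>P) = 0"
proof -
  have "(\<integral>\<omega>. Y \<omega> * Z \<omega> \<partial>P) = (\<integral>\<omega>. Y \<omega> * E_filt P a b Z \<omega> \<partial>P)"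
    using Z Y by (intro integral_mult_E_filt[symmetric]) (auto simp: increment_def)
  also have "\<dots> = (\<integral>\<omega>. 0 \<partial>P)"
  proof (rule integral_cong_AE)
    have "AE \<omega> in P. E_filt P a b Z \<omega> = 0"
      using Z ab by (auto simp: increment_def)
    then show "AE \<omega> in P. Y \<omega> * E_filt P a b Z \<omega> = 0" by eventually_elim simp
  qed (use Y in \<open>auto simp: square_integrable_def\<close>)
  finally show ?thesis by simp
qed

text \<open>If \<open>u < u'\<close> or \<open>v < v'\<close>, then \<open>Y\<close> is measurable
  for a quadrant on which \<open>Z\<close> has conditional expectation 0. Otherwise
  \<open>u' \<le> u\<close> and \<open>v' \<le> v\<close> with one inequality strict, and the roles
  are exchanged.\<close>

lemma increments_orthogonal:
  assumes "increment u v Y" "increment u' v' Z" "(u, v) \<noteq> (u', v')"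
  shows "(\<integral>\<omega>. Y \<omega> * Z \<omega> \<partial>P) = 0"
proof (cases "u < u' \<or> v < v'")
  case True
  with assms increment_orthogonal[of u' v' Z Y u v] show ?thesis
    by (auto simp: increment_def)
next
  case False
  with assms increment_orthogonal[of u v Y Z u' v'] show ?thesis
    by (auto simp: increment_def mult.commute)
qed

end

section \<open>Consequences of the commuting filtration\<close>

locale commuting_law_space = stationary_law_space +
  assumes commuting: "commuting_filt P"
begin

text \<open>For \<open>a < u\<close>, \<open>b > v\<close> the commutation is not assumed; it is obtained from the assumed
  case by self-adjointness, testing against indicators of sets in \<open>filt u v\<close>.\<close>

lemma E_filt_E_filt:
  assumes X: "integrable P X"
  shows "AE \<omega> in P. E_filt P u v (E_filt P a b X) \<omega> = E_filt P (min a u) (min b v) X \<omega>"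
proof -
  consider "u \<le> a" | "a < u" "b \<le> v" | "a < u" "v < b" by linarith
  then show ?thesis
  proof cases
    case 1
    then show ?thesis
      using commuting X unfolding commuting_filt_def by (simp add: min_absorb2)
  next
    case 2
    then have "E_filt P a b X \<in> borel_measurable (filt u v)"
      by (intro borel_measurable_E_filt) auto
    then show ?thesis
      using 2 X by (simp add: min_absorb1 filt.real_cond_exp_int)
  next
    case 3
    have "AE \<omega> in P. E_filt P u v (E_filt P a b X) \<omega> = E_filt P a v X \<omega>"
    proof (rule filt.real_cond_exp_charact)
      fix A assume A: "A \<in> sets (filt u v)"
      then have AP[measurable]: "A \<in> sets P"
        using sub_filt by (auto simp: subalgebra_def)
      let ?I = "indicator A :: omega \<Rightarrow> real"
      have I: "integrable P ?I" "?I \<in> borel_measurable (filt u v)"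
        using A by (auto simp: integrable_indicator_iff emeasure_eq_measure)
      have IX: "integrable P (\<lambda>\<omega>. ?I \<omega> * Y \<omega>)" if "integrable P Y" for Y
        using integrable_mult_indicator[OF AP that] by simp
      \<comment> \<open>The conditional expectation of an indicator lies between 0 and 1, so its
        product with a merely integrable variable is integrable.\<close>
      have XB: "integrable P (\<lambda>\<omega>. E_filt P c d ?I \<omega> * Y \<omega>)" if Y: "integrable P Y" for c d Y
      proof (rule Bochner_Integration.integrable_bound[OF Y])
        have "AE \<omega> in P. 0 \<le> E_filt P c d ?I \<omega>" "AE \<omega> in P. E_filt P c d ?I \<omega> \<le> 1"
          using I by (auto intro!: filt.real_cond_exp_ge_c filt.real_cond_exp_le_c simp: indicator_def)
        then show "AE \<omega> in P. norm (E_filt P c d ?I \<omega> * Y \<omega>) \<le> norm (Y \<omega>)"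
          by eventually_elim (auto simp: abs_mult mult_left_le_one_le)
      qed (use Y in simp)
      \<comment> \<open>Both sides equal the integral of the product of the two conditional
        expectations.\<close>
      have adj: "(\<integral>\<omega>. ?I \<omega> * E_filt P c d X \<omega> \<partial>P) = (\<integral>\<omega>. E_filt P c d ?I \<omega> * X \<omega> \<partial>P)" for c d
      proof -
        have "(\<integral>\<omega>. ?I \<omega> * E_filt P c d X \<omega> \<partial>P) = (\<integral>\<omega>. E_filt P c d X \<omega> * E_filt P c d ?I \<omega> \<partial>P)"
          using IX[of "E_filt P c d X"] X
          by (subst filt.real_cond_exp_intg) (auto simp: mult.commute filt.real_cond_exp_int)
        also have "\<dots> = (\<integral>\<omega>. E_filt P c d ?I \<omega> * E_filt P c d X \<omega> \<partial>P)"
          by (simp add: mult.commute)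
        also have "\<dots> = (\<integral>\<omega>. E_filt P c d ?I \<omega> * X \<omega> \<partial>P)"
          using XB[OF X] X by (intro filt.real_cond_exp_intg) auto
        finally show ?thesis .
      qed
      have "AE \<omega> in P. E_filt P u v ?I \<omega> = ?I \<omega>"
        using I by (rule filt.real_cond_exp_F_meas)
      then have "AE \<omega> in P. E_filt P a b (E_filt P u v ?I) \<omega> = E_filt P a b ?I \<omega>"
        by (rule filt.real_cond_exp_cong) auto
      \<comment> \<open>This is the assumed case of commutation: the inner first index
        \<open>u\<close> exceeds the outer \<open>a\<close>, and \<open>v < b\<close> makes the
        minimum equal to \<open>v\<close>.\<close>
      moreover have "AE \<omega> in P. E_filt P a b (E_filt P u v ?I) \<omega> = E_filt P a v ?I \<omega>"
        using commuting I(1) 3 unfolding commuting_filt_def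
        by (metis less_imp_le min.absorb1)
      ultimately have "AE \<omega> in P. E_filt P a b ?I \<omega> * X \<omega> = E_filt P a v ?I \<omega> * X \<omega>"
        by eventually_elim simp
      then have "(\<integral>\<omega>. E_filt P a b ?I \<omega> * X \<omega> \<partial>P) = (\<integral>\<omega>. E_filt P a v ?I \<omega> * X \<omega> \<partial>P)"
        using X by (intro integral_cong_AE) auto
      then show "(\<integral>\<omega>\<in>A. E_filt P a b X \<omega> \<partial>P) = (\<integral>\<omega>\<in>A. E_filt P a v X \<omega> \<partial>P)"
        using adj[of a b] adj[of a v] by (simp add: set_lebesgue_integral_def)
    next
      show "integrable P (E_filt P a b X)" "integrable P (E_filt P a v X)"
        using X by (auto intro: filt.real_cond_exp_int)
      show "E_filt P a v X \<in> borel_measurable (filt u v)"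
        using 3 by (intro borel_measurable_E_filt) auto
    qed
    with 3 show ?thesis by (simp add: min_absorb1 min_absorb2)
  qed
qed

text \<open>\<open>X\<close> agrees almost surely with its conditional expectation given
  \<open>filt a b\<close>, so commutation applies to \<open>X\<close> itself.\<close>

lemma E_filt_adapted:
  assumes X: "integrable P X" "X \<in> borel_measurable (filt a b)"
  shows "AE \<omega> in P. E_filt P u v X \<omega> = E_filt P (min a u) (min b v) X \<omega>"
proof -
  have "AE \<omega> in P. E_filt P a b X \<omega> = X \<omega>"
    using X by (rule filt.real_cond_exp_F_meas)
  then have "AE \<omega> in P. E_filt P u v (E_filt P a b X) \<omega> = E_filt P u v X \<omega>"
    using X by (intro filt.real_cond_exp_cong) auto
  with E_filt_E_filt[OF X(1), of u v a b] show ?thesis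
    by eventually_elim simp
qed

text \<open>If \<open>a < u\<close>, the indices \<open>u\<close> and \<open>u - 1\<close> are both
  cut down to \<open>a\<close>, and the four terms cancel in pairs; the case \<open>b < v\<close> is
  symmetric.\<close>

lemma proj_op_adapted_eq_0:
  assumes X: "integrable P X" "X \<in> borel_measurable (filt a b)" and "a < u \<or> b < v"
  shows "AE \<omega> in P. proj_op P u v X \<omega> = 0"
proof -
  have *: "min a u = min a (u - 1) \<or> min b v = min b (v - 1)"
    using assms(3) by auto
  show ?thesis
    using E_filt_adapted[OF X, of u v] E_filt_adapted[OF X, of "u - 1" v]
      E_filt_adapted[OF X, of u "v - 1"] E_filt_adapted[OF X, of "u - 1" "v - 1"]
    by eventually_elim (use * in \<open>auto simp: proj_op_def\<close>)
qed

text \<open>The same pairwise cancellation, now with the outer conditioning cutting down the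
  indices. Since they are integers, \<open>a < u\<close> gives \<open>a \<le> u - 1\<close>.\<close>

lemma increment_proj_op:
  assumes X: "square_integrable P X"
  shows "increment u v (proj_op P u v X)"
proof -
  have iX: "integrable P X" by (rule square_integrable_imp_integrable_P[OF X])
  have "AE \<omega> in P. E_filt P a b (proj_op P u v X) \<omega> = 0" if ab: "a < u \<or> b < v" for a b
  proof -
    have int: "integrable P (E_filt P c d X)" for c d
      using iX by (rule filt.real_cond_exp_int)
    let ?E = "\<lambda>c d. E_filt P a b (E_filt P c d X)"
    have *: "min u a = min (u - 1) a \<or> min v b = min (v - 1) b"
      using ab by auto
    have "AE \<omega> in P. E_filt P a b (proj_op P u v X) \<omega>
        = E_filt P a b (\<lambda>\<omega>. E_filt P u v X \<omega> - E_filt P u (v - 1) X \<omega> - E_filt P (u - 1) v X \<omega>) \<omega>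
          + ?E (u - 1) (v - 1) \<omega>"
      unfolding proj_op_def
      by (intro filt.real_cond_exp_add Bochner_Integration.integrable_diff int)
    moreover have "AE \<omega> in P.
        E_filt P a b (\<lambda>\<omega>. E_filt P u v X \<omega> - E_filt P u (v - 1) X \<omega> - E_filt P (u - 1) v X \<omega>) \<omega>
        = E_filt P a b (\<lambda>\<omega>. E_filt P u v X \<omega> - E_filt P u (v - 1) X \<omega>) \<omega> - ?E (u - 1) v \<omega>"
      by (intro filt.real_cond_exp_diff Bochner_Integration.integrable_diff int)
    moreover have "AE \<omega> in P. E_filt P a b (\<lambda>\<omega>. E_filt P u v X \<omega> - E_filt P u (v - 1) X \<omega>) \<omega>
        = ?E u v \<omega> - ?E u (v - 1) \<omega>"
      by (intro filt.real_cond_exp_diff int)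
    ultimately show ?thesis
      using E_filt_E_filt[OF iX, of a b u v] E_filt_E_filt[OF iX, of a b "u - 1" v]
        E_filt_E_filt[OF iX, of a b u "v - 1"] E_filt_E_filt[OF iX, of a b "u - 1" "v - 1"]
      by eventually_elim (use * in auto)
  qed
  moreover have "proj_op P u v X \<in> borel_measurable (filt u v)"
    unfolding proj_op_def
    by (intro borel_measurable_add borel_measurable_diff borel_measurable_E_filt) auto
  ultimately show ?thesis
    using X by (auto simp: increment_def square_integrable_proj_op)
qed

section \<open>Norm of the boundary part\<close>

text \<open>The boundary part \<open>X - \<Sum> \<P>\<^sub>u\<^sub>,\<^sub>v(X)\<close> of an \<open>\<F>\<^sub>n\<^sub>,\<^sub>m\<close>-measurable \<open>X\<close>.\<close>

definition boundary_part :: "int \<Rightarrow> int \<Rightarrow> (omega \<Rightarrow> real) \<Rightarrow> omega \<Rightarrow> real" where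
  "boundary_part n m X \<omega> = E_filt P 0 m X \<omega> + E_filt P n 0 X \<omega> - E_filt P 0 0 X \<omega>"

lemma square_integrable_boundary_part:
  assumes "square_integrable P X"
  shows "square_integrable P (boundary_part n m X)"
  unfolding boundary_part_def[abs_def]
  using assms by (intro square_integrable_add square_integrable_diff square_integrable_E_filt)

text \<open>Write A, B, C for the three conditional expectations, so that the boundary part is A + B
  - C. The inner products of A with B, A with C and B with C all equal the squared norm of C, which
  therefore appears with coefficient 1 + 2 - 2 - 2 = -1 when the square is expanded.\<close>

lemma integral_boundary_part_square:
  assumes X: "square_integrable P X" and nm: "0 \<le> n" "0 \<le> m"
  shows "(\<integral>\<omega>. (boundary_part n m X \<omega>)\<^sup>2 \<partial>P) = (\<integral>\<omega>. (E_filt P 0 m X \<omega>)\<^sup>2 \<partial>P)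
      + (\<integral>\<omega>. (E_filt P n 0 X \<omega>)\<^sup>2 \<partial>P) - (\<integral>\<omega>. (E_filt P 0 0 X \<omega>)\<^sup>2 \<partial>P)" (is "_ = ?R")
    and "(\<integral>\<omega>. (E_filt P 0 0 X \<omega>)\<^sup>2 \<partial>P) \<le> (\<integral>\<omega>. (E_filt P 0 m X \<omega>)\<^sup>2 \<partial>P)"
    and "(\<integral>\<omega>. (E_filt P 0 0 X \<omega>)\<^sup>2 \<partial>P) \<le> (\<integral>\<omega>. (E_filt P n 0 X \<omega>)\<^sup>2 \<partial>P)"
proof -
  let ?A = "E_filt P 0 m X" and ?B = "E_filt P n 0 X" and ?C = "E_filt P 0 0 X"
  have sq: "square_integrable P ?A" "square_integrable P ?B" "square_integrable P ?C"
    using X by (auto intro: square_integrable_E_filt)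
  have CE: "(\<integral>\<omega>. ?C \<omega> * E_filt P a b X \<omega> \<partial>P) = (\<integral>\<omega>. ?C \<omega> * X \<omega> \<partial>P)" if "0 \<le> a" "0 \<le> b" for a b
    using X sq(3) that by (intro integral_mult_E_filt borel_measurable_E_filt) auto
  have CC: "(\<integral>\<omega>. (?C \<omega>)\<^sup>2 \<partial>P) = (\<integral>\<omega>. ?C \<omega> * X \<omega> \<partial>P)"
    using CE[of 0 0] by (simp add: power2_eq_square)
  \<comment> \<open>Since \<open>?A\<close> is measurable for \<open>filt 0 m\<close>,
    \<open>?B\<close> may be conditioned on it, and commutation turns the result into
    \<open>?C\<close>.\<close>
  have "(\<integral>\<omega>. ?A \<omega> * ?B \<omega> \<partial>P) = (\<integral>\<omega>. ?A \<omega> * E_filt P 0 m ?B \<omega> \<partial>P)"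
    using sq by (intro integral_mult_E_filt[symmetric]) auto
  also have "\<dots> = (\<integral>\<omega>. ?A \<omega> * ?C \<omega> \<partial>P)"
  proof (rule integral_cong_AE)
    have "AE \<omega> in P. E_filt P 0 m ?B \<omega> = ?C \<omega>"
      using E_filt_E_filt[OF square_integrable_imp_integrable_P[OF X], of 0 m n 0] nm
      by (simp add: min_absorb1 min_absorb2)
    then show "AE \<omega> in P. ?A \<omega> * E_filt P 0 m ?B \<omega> = ?A \<omega> * ?C \<omega>" by eventually_elim simp
  qed auto
  finally have AB: "(\<integral>\<omega>. ?A \<omega> * ?B \<omega> \<partial>P) = (\<integral>\<omega>. (?C \<omega>)\<^sup>2 \<partial>P)"
    using CE[of 0 m] CC nm by (simp add: mult.commute)
  note int = square_integrable_mult[OF sq(1) sq(2)] square_integrable_mult[OF sq(3) sq(1)]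
    square_integrable_mult[OF sq(3) sq(2)] sq[unfolded square_integrable_def]
  have "(boundary_part n m X \<omega>)\<^sup>2 = (?A \<omega>)\<^sup>2 + (?B \<omega>)\<^sup>2 + (?C \<omega>)\<^sup>2
      + 2 * (?A \<omega> * ?B \<omega>) - 2 * (?C \<omega> * ?A \<omega>) - 2 * (?C \<omega> * ?B \<omega>)" for \<omega>
    by (simp add: boundary_part_def power2_eq_square algebra_simps)
  then have "(\<integral>\<omega>. (boundary_part n m X \<omega>)\<^sup>2 \<partial>P) = (\<integral>\<omega>. (?A \<omega>)\<^sup>2 \<partial>P) + (\<integral>\<omega>. (?B \<omega>)\<^sup>2 \<partial>P)
      + (\<integral>\<omega>. (?C \<omega>)\<^sup>2 \<partial>P) + 2 * (\<integral>\<omega>. ?A \<omega> * ?B \<omega> \<partial>P) - 2 * (\<integral>\<omega>. ?C \<omega> * ?A \<omega> \<partial>P)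
      - 2 * (\<integral>\<omega>. ?C \<omega> * ?B \<omega> \<partial>P)"
    using int by simp
  then show "(\<integral>\<omega>. (boundary_part n m X \<omega>)\<^sup>2 \<partial>P) = ?R"
    using CE[of 0 m] CE[of n 0] CC AB nm by simp
  have le: "(\<integral>\<omega>. (?C \<omega>)\<^sup>2 \<partial>P) \<le> (\<integral>\<omega>. (E_filt P a b X \<omega>)\<^sup>2 \<partial>P)" if "0 \<le> a" "0 \<le> b" for a b
  proof -
    have sqE: "square_integrable P (E_filt P a b X)"
      using X by (rule square_integrable_E_filt)
    \<comment> \<open>By orthogonality this nonnegative number is the difference of the two squared
      norms.\<close>
    have "0 \<le> (\<integral>\<omega>. (?C \<omega> - E_filt P a b X \<omega>)\<^sup>2 \<partial>P)" by simp
    also have "\<dots> = (\<integral>\<omega>. (?C \<omega>)\<^sup>2 \<partial>P) + (\<integral>\<omega>. (E_filt P a b X \<omega>)\<^sup>2 \<partial>P)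
        - 2 * (\<integral>\<omega>. ?C \<omega> * E_filt P a b X \<omega> \<partial>P)"
      using sqE sq(3) square_integrable_mult[OF sq(3) sqE]
      by (simp add: square_integrable_def power2_diff mult.assoc)
    finally show ?thesis using CE[OF that] CC by simp
  qed
  show "(\<integral>\<omega>. (?C \<omega>)\<^sup>2 \<partial>P) \<le> (\<integral>\<omega>. (?A \<omega>)\<^sup>2 \<partial>P)" "(\<integral>\<omega>. (?C \<omega>)\<^sup>2 \<partial>P) \<le> (\<integral>\<omega>. (?B \<omega>)\<^sup>2 \<partial>P)"
    using le nm by auto
qed

text \<open>The first two bounds extract condition (ii) from a martingale approximation; the third
  serves the converse.\<close>

lemma L2_norm_sq_boundary_part:
  assumes X: "square_integrable P X" and nm: "0 \<le> n" "0 \<le> m"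
  shows "L2_norm_sq P (E_filt P 0 m X) \<le> L2_norm_sq P (boundary_part n m X)"
    and "L2_norm_sq P (E_filt P n 0 X) \<le> L2_norm_sq P (boundary_part n m X)"
    and "L2_norm_sq P (boundary_part n m X)
           \<le> L2_norm_sq P (E_filt P 0 m X) + L2_norm_sq P (E_filt P n 0 X)"
  using integral_boundary_part_square[OF assms]
  by (simp_all add: L2_norm_sq_eq_integral square_integrable_boundary_part square_integrable_E_filt X
      ennreal_leI flip: ennreal_plus)

lemma increment_martingale_difference:
  assumes D: "martingale_differences_field P D" and "square_integrable P (D u v)"
  shows "increment u v (D u v)"
  using assms field_of_measurable_filt
  by (auto simp: martingale_differences_field_def increment_def)

text \<open>By stationarity the norm is the same at both sites; the offset from
  \<open>(a, b)\<close> to \<open>(u, v)\<close> must be nonnegative to use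
  \<open>distr_translation\<close>.\<close>

lemma square_integrable_field_of:
  assumes d: "d \<in> past_functionals" and sq: "square_integrable P (field_of d a b)"
    and "a \<le> u" "b \<le> v"
  shows "square_integrable P (field_of d u v)"
proof -
  have eq: "field_of d u v = (\<lambda>\<omega>. field_of d a b (translation (int (nat (u - a))) (int (nat (v - b))) \<omega>))"
    using assms by (simp add: field_of_translation)
  have "L2_norm_sq P (field_of d u v) = L2_norm_sq P (field_of d a b)"
    unfolding eq using sq by (intro L2_norm_sq_translation) (simp add: square_integrable_def)
  moreover have "field_of d u v \<in> borel_measurable P"
    using field_of_measurable_filt[OF d] by (rule borel_measurable_P)
  ultimately show ?thesis
    using sq by (simp add: square_integrable_iff_L2_norm_sq)
qed

end

section \<open>Orthogonal decomposition of the approximation error\<close>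

locale square_integrable_field = commuting_law_space +
  fixes f :: "omega \<Rightarrow> real" and X :: "int \<Rightarrow> int \<Rightarrow> omega \<Rightarrow> real"
  assumes past: "f \<in> past_functionals" and X_eq: "X = field_of f"
    and sq_0: "square_integrable P (X 0 0)"
begin

lemma X_measurable_filt: "u \<le> n \<Longrightarrow> v \<le> m \<Longrightarrow> X u v \<in> borel_measurable (filt n m)"
  unfolding X_eq by (rule borel_measurable_filt_mono[OF field_of_measurable_filt[OF past]])

lemma square_integrable_X: "0 \<le> u \<Longrightarrow> 0 \<le> v \<Longrightarrow> square_integrable P (X u v)"
  using square_integrable_field_of[OF past] sq_0 unfolding X_eq by blast

lemma square_integrable_partial_sum: "square_integrable P (partial_sum X n m)"
  unfolding partial_sum_def[abs_def]
  by (intro square_integrable_sum square_integrable_X) auto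

lemma partial_sum_measurable_filt: "partial_sum X n m \<in> borel_measurable (filt (int n) (int m))"
  unfolding partial_sum_def[abs_def]
  by (intro borel_measurable_sum X_measurable_filt) auto

text \<open>The projection kills every term of the sum at a site left of column \<open>u\<close> or
  below row \<open>v\<close>. What remains is a rectangle with sides \<open>n - u + 1\<close> and
  \<open>m - v + 1\<close>, the translate by \<open>(u - 1, v - 1)\<close> of one starting at
  \<open>(1, 1)\<close>.\<close>

lemma proj_op_partial_sum:
  assumes "u \<in> {1..int n}" "v \<in> {1..int m}"
  shows "AE \<omega> in P. proj_op P u v (partial_sum X n m) \<omega>
    = proj_op P 1 1 (partial_sum X (nat (int n - u + 1)) (nat (int m - v + 1)))
        (translation (int (nat (u - 1))) (int (nat (v - 1))) \<omega>)"
proof -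
  let ?j = "nat (int n - u + 1)" and ?k = "nat (int m - v + 1)"
  let ?p = "nat (u - 1)" and ?q = "nat (v - 1)"
  let ?\<theta> = "translation (int ?p) (int ?q)"
  let ?I = "{1..int n} \<times> {1..int m}" and ?J = "{u..int n} \<times> {v..int m}"
  \<comment> \<open>\<open>proj_op_sum\<close> asks for integrability at every index;
    \<open>max 0\<close> provides it and changes no term inside the rectangle.\<close>
  let ?Y = "\<lambda>i. X (max 0 (fst i)) (max 0 (snd i))"
  have intY: "integrable P (?Y i)" for i
    by (intro square_integrable_imp_integrable_P square_integrable_X) auto
  have J: "?J \<subseteq> ?I" using assms by auto
  have S: "partial_sum X n m = (\<lambda>\<omega>. \<Sum>i\<in>?I. ?Y i \<omega>)"
    unfolding partial_sum_eq_sum_Times[abs_def] by (intro ext sum.cong) auto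
  have S': "(\<lambda>\<omega>. partial_sum X ?j ?k (?\<theta> \<omega>)) = (\<lambda>\<omega>. \<Sum>i\<in>?J. ?Y i \<omega>)"
  proof
    fix \<omega>
    have "partial_sum X ?j ?k (?\<theta> \<omega>)
        = (\<Sum>(a, b)\<in>{1..int ?j} \<times> {1..int ?k}. X (a + (u - 1)) (b + (v - 1)) \<omega>)"
      using assms by (simp add: partial_sum_eq_sum_Times X_eq field_of_translation)
    also have "\<dots> = (\<Sum>i\<in>?J. ?Y i \<omega>)"
      by (rule sum.reindex_bij_witness[of _ "\<lambda>(a, b). (a - (u - 1), b - (v - 1))"
            "\<lambda>(a, b). (a + (u - 1), b + (v - 1))"]) (use assms in auto)
    finally show "partial_sum X ?j ?k (?\<theta> \<omega>) = (\<Sum>i\<in>?J. ?Y i \<omega>)" .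
  qed
  have "AE \<omega> in P. proj_op P u v (?Y i) \<omega> = 0" if "i \<in> ?I - ?J" for i
    using that by (intro proj_op_adapted_eq_0[OF intY X_measurable_filt[OF order_refl order_refl]]) auto
  then have "AE \<omega> in P. \<forall>i\<in>?I - ?J. proj_op P u v (?Y i) \<omega> = 0"
    by (intro AE_finite_allI) auto
  moreover have "AE \<omega> in P. proj_op P u v (partial_sum X n m) \<omega> = (\<Sum>i\<in>?I. proj_op P u v (?Y i) \<omega>)"
    unfolding S by (rule proj_op_sum[OF intY])
  moreover have "AE \<omega> in P. proj_op P u v (\<lambda>\<omega>. partial_sum X ?j ?k (?\<theta> \<omega>)) \<omega>
      = (\<Sum>i\<in>?J. proj_op P u v (?Y i) \<omega>)"
    unfolding S' by (rule proj_op_sum[OF intY])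
  moreover have "AE \<omega> in P. proj_op P u v (\<lambda>\<omega>. partial_sum X ?j ?k (?\<theta> \<omega>)) \<omega>
      = proj_op P 1 1 (partial_sum X ?j ?k) (?\<theta> \<omega>)"
    using proj_op_translation[OF square_integrable_imp_integrable_P[OF square_integrable_partial_sum],
        of 1 ?p 1 ?q ?j ?k] assms by simp
  ultimately show ?thesis
  proof eventually_elim
    case (elim \<omega>)
    have "(\<Sum>i\<in>?I. proj_op P u v (?Y i) \<omega>) = (\<Sum>i\<in>?J. proj_op P u v (?Y i) \<omega>)"
      using elim(1) J by (intro sum.mono_neutral_right) auto
    with elim show ?case by simp
  qed
qed

lemma L2_norm_sq_partial_sum_diff:
  assumes D: "martingale_differences_field P D" and sq: "square_integrable P (D 1 1)"
  shows "L2_norm_sq P (\<lambda>\<omega>. partial_sum X n m \<omega> - partial_sum D n m \<omega>)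
    = (\<Sum>j = 1..n. \<Sum>k = 1..m.
         L2_norm_sq P (\<lambda>\<omega>. proj_op P 1 1 (partial_sum X j k) \<omega> - D 1 1 \<omega>))
      + L2_norm_sq P (boundary_part (int n) (int m) (partial_sum X n m))"
proof -
  let ?S = "partial_sum X n m"
  let ?I = "{1..int n} \<times> {1..int m}"
  let ?R = "boundary_part (int n) (int m) ?S"
  define \<Delta> where "\<Delta> = (\<lambda>(u, v) \<omega>. proj_op P u v ?S \<omega> - D u v \<omega>)"
  obtain d where d: "d \<in> past_functionals" "D = field_of d"
    using D by (auto simp: martingale_differences_field_def)
  have sqD: "square_integrable P (D u v)" if "(u, v) \<in> ?I" for u v
    using square_integrable_field_of[OF d(1), of 1 1 u v] sq that by (auto simp: d(2))
  have inc: "increment u v (\<Delta> (u, v))" if "(u, v) \<in> ?I" for u v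
    unfolding \<Delta>_def prod.case
    by (intro increment_diff increment_proj_op square_integrable_partial_sum
        increment_martingale_difference[OF D] sqD that)
  have sq\<Delta>: "square_integrable P (\<Delta> i)" if "i \<in> ?I" for i
    using inc[of "fst i" "snd i"] that by (simp add: increment_def)
  have sqR: "square_integrable P ?R"
    by (intro square_integrable_boundary_part square_integrable_partial_sum)
  have "AE \<omega> in P. E_filt P (int n) (int m) ?S \<omega> = ?S \<omega>"
    by (intro filt.real_cond_exp_F_meas square_integrable_imp_integrable_P
        square_integrable_partial_sum partial_sum_measurable_filt)
  \<comment> \<open>Adaptedness turns the corner term at \<open>(n, m)\<close> into
    \<open>?S\<close>; the other three corners add up to minus \<open>?R\<close>.\<close>
  then have "AE \<omega> in P. ?S \<omega> - partial_sum D n m \<omega> = (\<Sum>i\<in>?I. \<Delta> i \<omega>) + ?R \<omega>"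
  proof eventually_elim
    case (elim \<omega>)
    have "(\<Sum>i\<in>?I. \<Delta> i \<omega>)
        = (\<Sum>u = 1..int n. \<Sum>v = 1..int m. proj_op P u v ?S \<omega>) - partial_sum D n m \<omega>"
      by (simp add: \<Delta>_def partial_sum_def sum.cartesian_product case_prod_beta sum_subtractf)
    then show ?case
      using elim by (simp add: sum_proj_op boundary_part_def)
  qed
  then have "L2_norm_sq P (\<lambda>\<omega>. ?S \<omega> - partial_sum D n m \<omega>)
      = L2_norm_sq P (\<lambda>\<omega>. (\<Sum>i\<in>?I. \<Delta> i \<omega>) + ?R \<omega>)"
    by (rule L2_norm_sq_cong_AE)
  also have "\<dots> = ennreal (\<integral>\<omega>. ((\<Sum>i\<in>?I. \<Delta> i \<omega>) + ?R \<omega>)\<^sup>2 \<partial>P)"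
    by (intro L2_norm_sq_eq_integral square_integrable_add square_integrable_sum sq\<Delta> sqR)
  also have "(\<integral>\<omega>. ((\<Sum>i\<in>?I. \<Delta> i \<omega>) + ?R \<omega>)\<^sup>2 \<partial>P)
      = (\<integral>\<omega>. (\<Sum>i\<in>?I. \<Delta> i \<omega>)\<^sup>2 \<partial>P) + (\<integral>\<omega>. (?R \<omega>)\<^sup>2 \<partial>P)"
  proof (rule integral_square_add_orthogonal)
    \<comment> \<open>Each term of \<open>?R\<close> is measurable for a quadrant with some index 0,
      which lies below the corresponding index of the site \<open>i\<close>.\<close>
    have E: "(\<integral>\<omega>. E_filt P a b ?S \<omega> * \<Delta> i \<omega> \<partial>P) = 0" if "i \<in> ?I" "a < 1 \<or> b < 1" for a b i
      using inc[of "fst i" "snd i"] that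
      by (intro increment_orthogonal[of "fst i" "snd i" _ _ a b] square_integrable_E_filt
          square_integrable_partial_sum) auto
    have int: "integrable P (\<lambda>\<omega>. E_filt P a b ?S \<omega> * \<Delta> i \<omega>)" if "i \<in> ?I" for a b i
      by (intro square_integrable_mult square_integrable_E_filt square_integrable_partial_sum sq\<Delta> that)
    have "(\<integral>\<omega>. \<Delta> i \<omega> * ?R \<omega> \<partial>P) = 0" if i: "i \<in> ?I" for i
    proof -
      have "\<Delta> i \<omega> * ?R \<omega> = E_filt P 0 (int m) ?S \<omega> * \<Delta> i \<omega> + E_filt P (int n) 0 ?S \<omega> * \<Delta> i \<omega>
          - E_filt P 0 0 ?S \<omega> * \<Delta> i \<omega>" for \<omega>
        by (simp add: boundary_part_def algebra_simps)
      then show ?thesis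
        using int[OF i] E[OF i] by simp
    qed
    then show "(\<integral>\<omega>. (\<Sum>i\<in>?I. \<Delta> i \<omega>) * ?R \<omega> \<partial>P) = 0"
      unfolding sum_distrib_right
      by (subst Bochner_Integration.integral_sum) (auto intro!: square_integrable_mult sq\<Delta> sqR)
  qed (rule square_integrable_sum, erule sq\<Delta>, rule sqR)
  also have "(\<integral>\<omega>. (\<Sum>i\<in>?I. \<Delta> i \<omega>)\<^sup>2 \<partial>P) = (\<Sum>i\<in>?I. \<integral>\<omega>. (\<Delta> i \<omega>)\<^sup>2 \<partial>P)"
  proof (intro integral_square_sum_orthogonal sq\<Delta>)
    fix i j assume "i \<in> ?I" "j \<in> ?I" "i \<noteq> j"
    then show "(\<integral>\<omega>. \<Delta> i \<omega> * \<Delta> j \<omega> \<partial>P) = 0"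
      using inc[of "fst i" "snd i"] inc[of "fst j" "snd j"] by (intro increments_orthogonal) auto
  qed auto
  also have "ennreal (\<dots> + (\<integral>\<omega>. (?R \<omega>)\<^sup>2 \<partial>P)) = (\<Sum>i\<in>?I. L2_norm_sq P (\<Delta> i)) + L2_norm_sq P ?R"
    by (simp add: L2_norm_sq_eq_integral sq\<Delta> sqR sum_nonneg flip: sum_ennreal)
  also have "(\<Sum>i\<in>?I. L2_norm_sq P (\<Delta> i)) = (\<Sum>(j, k)\<in>{1..n} \<times> {1..m}.
         L2_norm_sq P (\<lambda>\<omega>. proj_op P 1 1 (partial_sum X j k) \<omega> - D 1 1 \<omega>))"
  \<comment> \<open>The reflection of the rectangle sends the site \<open>(u, v)\<close> to the side
    lengths of the subrectangle that remains visible to its projection.\<close>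
  proof (rule sum.reindex_bij_witness[of _ "\<lambda>(j, k). (int n - int j + 1, int m - int k + 1)"
        "\<lambda>(u, v). (nat (int n - u + 1), nat (int m - v + 1))"])
    fix i assume "i \<in> ?I"
    then obtain u v where i: "i = (u, v)" and uv: "u \<in> {1..int n}" "v \<in> {1..int m}" by auto
    let ?\<theta> = "translation (int (nat (u - 1))) (int (nat (v - 1)))"
    let ?Z = "\<lambda>\<omega>. proj_op P 1 1 (partial_sum X (nat (int n - u + 1)) (nat (int m - v + 1))) \<omega> - D 1 1 \<omega>"
    have "D u v \<omega> = D 1 1 (?\<theta> \<omega>)" for \<omega>
      using uv by (simp add: d(2) field_of_translation)
    then have "AE \<omega> in P. \<Delta> i \<omega> = ?Z (?\<theta> \<omega>)"
      using proj_op_partial_sum[OF uv] by (auto simp: i \<Delta>_def)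
    then have "L2_norm_sq P (\<Delta> i) = L2_norm_sq P (\<lambda>\<omega>. ?Z (?\<theta> \<omega>))"
      by (rule L2_norm_sq_cong_AE)
    also have "\<dots> = L2_norm_sq P ?Z"
      by (intro L2_norm_sq_translation square_integrable_measurable square_integrable_diff
          square_integrable_proj_op square_integrable_partial_sum sq)
    finally show "(case (case i of (u, v) \<Rightarrow> (nat (int n - u + 1), nat (int m - v + 1))) of (j, k) \<Rightarrow>
        L2_norm_sq P (\<lambda>\<omega>. proj_op P 1 1 (partial_sum X j k) \<omega> - D 1 1 \<omega>)) = L2_norm_sq P (\<Delta> i)"
      by (simp add: i)
  qed auto
  finally show ?thesis
    by (simp add: sum.cartesian_product)
qed

text \<open>The martingale sum is \<open>partial_sum X n m\<close> minus the error, hence square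
  integrable. Conditioning it on \<open>filt 1 1\<close> removes every difference except
  \<open>D 1 1\<close>, and the conditional expectation stays square integrable.\<close>

lemma square_integrable_of_partial_sum_diff:
  assumes D: "martingale_differences_field P D" and nm: "1 \<le> n" "1 \<le> m"
    and fin: "L2_norm_sq P (\<lambda>\<omega>. partial_sum X n m \<omega> - partial_sum D n m \<omega>) < \<infinity>"
  shows "square_integrable P (D 1 1)"
proof -
  let ?I = "{1..int n} \<times> {1..int m}"
  obtain d where d: "d \<in> past_functionals" "D = field_of d"
    using D by (auto simp: martingale_differences_field_def)
  have intD: "integrable P (D u v)" for u v
    using D by (auto simp: martingale_differences_field_def)
  have D11: "D 1 1 \<in> borel_measurable (filt 1 1)"
    using field_of_measurable_filt[OF d(1)] by (simp add: d(2))
  have [measurable]: "D u v \<in> borel_measurable P" for u v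
    using intD by auto
  have M: "partial_sum D n m = (\<lambda>\<omega>. \<Sum>i\<in>?I. D (fst i) (snd i) \<omega>)"
    by (simp add: partial_sum_eq_sum_Times[abs_def] case_prod_beta)
  have "partial_sum D n m \<in> borel_measurable P"
    unfolding M by measurable
  then have "square_integrable P (\<lambda>\<omega>. partial_sum X n m \<omega> - partial_sum D n m \<omega>)"
    using fin square_integrable_partial_sum[of n m]
    by (auto simp: square_integrable_iff_L2_norm_sq intro: borel_measurable_diff)
  from square_integrable_diff[OF square_integrable_partial_sum[of n m] this]
  have "square_integrable P (partial_sum D n m)" by simp
  then have sqE: "square_integrable P (E_filt P 1 1 (partial_sum D n m))"
    by (rule square_integrable_E_filt)
  have "AE \<omega> in P. E_filt P 1 1 (D (fst i) (snd i)) \<omega> = 0" if "i \<in> ?I - {(1, 1)}" for i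
  proof -
    have "1 < fst i \<or> 1 < snd i"
      using that by (cases i) auto
    then show ?thesis
      using D unfolding martingale_differences_field_def by blast
  qed
  then have "AE \<omega> in P. \<forall>i\<in>?I - {(1, 1)}. E_filt P 1 1 (D (fst i) (snd i)) \<omega> = 0"
    by (intro AE_finite_allI) auto
  moreover have "AE \<omega> in P. E_filt P 1 1 (partial_sum D n m) \<omega>
      = (\<Sum>i\<in>?I. E_filt P 1 1 (D (fst i) (snd i)) \<omega>)"
    unfolding M using intD by (rule filt.real_cond_exp_sum)
  moreover have "AE \<omega> in P. E_filt P 1 1 (D 1 1) \<omega> = D 1 1 \<omega>"
    using intD D11 by (rule filt.real_cond_exp_F_meas)
  ultimately have "AE \<omega> in P. E_filt P 1 1 (partial_sum D n m) \<omega> = D 1 1 \<omega>"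
  proof eventually_elim
    case (elim \<omega>)
    have "(\<Sum>i\<in>?I. E_filt P 1 1 (D (fst i) (snd i)) \<omega>)
        = (\<Sum>i\<in>{(1, 1)}. E_filt P 1 1 (D (fst i) (snd i)) \<omega>)"
      using elim(1) nm by (intro sum.mono_neutral_right) auto
    with elim show ?case by simp
  qed
  from L2_norm_sq_cong_AE[OF this] sqE show ?thesis
    by (simp add: square_integrable_iff_L2_norm_sq)
qed

lemma square_integrable_of_proj_op_diff:
  assumes D: "martingale_differences_field P D"
    and fin: "L2_norm_sq P (\<lambda>\<omega>. proj_op P 1 1 (partial_sum X j k) \<omega> - D 1 1 \<omega>) < \<infinity>"
  shows "square_integrable P (D 1 1)"
proof -
  let ?p = "proj_op P 1 1 (partial_sum X j k)"
  have p: "square_integrable P ?p"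
    by (intro square_integrable_proj_op square_integrable_partial_sum)
  moreover have "D 1 1 \<in> borel_measurable P"
    using D by (auto simp: martingale_differences_field_def)
  ultimately have "square_integrable P (\<lambda>\<omega>. ?p \<omega> - D 1 1 \<omega>)"
    using fin by (auto simp: square_integrable_iff_L2_norm_sq intro: borel_measurable_diff)
  from square_integrable_diff[OF p this] show ?thesis by simp
qed

end

section \<open>Limits along \<open>min_to_infinity\<close>, and the equivalence\<close>

lemma eventually_min_to_infinity: "\<forall>\<^sub>F x in min_to_infinity. 1 \<le> fst x \<and> 1 \<le> snd x"
proof -
  have "\<forall>\<^sub>F k in at_top. (1::nat) \<le> k" by (rule eventually_ge_at_top)
  from eventually_filtercomapI[OF this, of "\<lambda>(n, m). min n m"] show ?thesis
    unfolding min_to_infinity_def by (rule eventually_mono) auto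
qed

text \<open>The diagonal pairs \<open>(n, n)\<close> show that the minimum takes every
  value.\<close>

lemma min_to_infinity_neq_bot: "min_to_infinity \<noteq> bot"
  unfolding min_to_infinity_def
  by (rule filtercomap_neq_bot_surj) (auto intro!: surjI[of _ "\<lambda>n. (n, n)"])

text \<open>Supplies the single finite value that makes \<open>D 1 1\<close> square integrable.
  Positive \<open>n\<close> and \<open>m\<close> matter: otherwise the factor
  \<open>1 / (n * m)\<close> is 0 by convention and the product is finite even for an infinite
  norm.\<close>

lemma tendsto_0_min_to_infinityE:
  fixes g :: "nat \<times> nat \<Rightarrow> ennreal"
  assumes "(g \<longlongrightarrow> 0) min_to_infinity"
  obtains n m where "1 \<le> n" "1 \<le> m" "g (n, m) < \<infinity>"
proof -
  have "\<forall>\<^sub>F x in min_to_infinity. g x < \<infinity>"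
    using assms by (rule order_tendstoD) simp
  with eventually_min_to_infinity have "\<forall>\<^sub>F x in min_to_infinity. (1 \<le> fst x \<and> 1 \<le> snd x) \<and> g x < \<infinity>"
    by (rule eventually_conj)
  then have "\<exists>x. (1 \<le> fst x \<and> 1 \<le> snd x) \<and> g x < \<infinity>"
    by (rule eventually_happens'[OF min_to_infinity_neq_bot])
  then show ?thesis using that by auto
qed

lemma tendsto_0_le_ennreal:
  fixes f g :: "'a \<Rightarrow> ennreal"
  assumes "(g \<longlongrightarrow> 0) F" "\<And>x. f x \<le> g x"
  shows "(f \<longlongrightarrow> 0) F"
  by (rule tendsto_sandwich[of "\<lambda>_. 0" f F g]) (use assms in auto)

theorem theorem3:
  fixes P :: "omega measure"
    and f :: "omega \<Rightarrow> real"
    and X :: "int \<Rightarrow> int \<Rightarrow> omega \<Rightarrow> real"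
    and S :: "nat \<Rightarrow> nat \<Rightarrow> omega \<Rightarrow> real"
  assumes "stationary_law P"
    and "commuting_filt P"
    and "f \<in> past_functionals"
    and "X = field_of f"
    and "integrable P (X 0 0)"
    and "integrable P (\<lambda>\<omega>. (X 0 0 \<omega>)\<^sup>2)"
    and "integral\<^sup>L P (X 0 0) = 0"
    and "S = partial_sum X"
  shows "admits_martingale_approximation P X \<longleftrightarrow>
    (\<exists>D. martingale_differences_field P D \<and>
       ((\<lambda>(n, m). ennreal (1 / (real n * real m)) *
           (\<Sum>j = 1..n. \<Sum>k = 1..m. L2_norm_sq P (\<lambda>\<omega>. proj_op P 1 1 (S j k) \<omega> - D 1 1 \<omega>)))
         \<longlongrightarrow> 0) min_to_infinity) \<and>
    ((\<lambda>(n, m). ennreal (1 / (real n * real m)) * L2_norm_sq P (E_filt P 0 (int m) (S n m)))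
       \<longlongrightarrow> 0) min_to_infinity \<and>
    ((\<lambda>(n, m). ennreal (1 / (real n * real m)) * L2_norm_sq P (E_filt P (int n) 0 (S n m)))
       \<longlongrightarrow> 0) min_to_infinity"
proof -
  interpret square_integrable_field P f X
    using assms by unfold_locales (auto simp: square_integrable_def)
  note S = assms(8)
  let ?c = "\<lambda>n m. ennreal (1 / (real n * real m))"
  let ?A = "\<lambda>D (n, m). ?c n m * L2_norm_sq P (\<lambda>\<omega>. partial_sum X n m \<omega> - partial_sum D n m \<omega>)"
  let ?B = "\<lambda>D (n, m). ?c n m *
    (\<Sum>j = 1..n. \<Sum>k = 1..m. L2_norm_sq P (\<lambda>\<omega>. proj_op P 1 1 (S j k) \<omega> - D 1 1 \<omega>))"
  let ?R = "\<lambda>(n, m). ?c n m * L2_norm_sq P (boundary_part (int n) (int m) (S n m))"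
  let ?C1 = "\<lambda>(n, m). ?c n m * L2_norm_sq P (E_filt P 0 (int m) (S n m))"
  let ?C2 = "\<lambda>(n, m). ?c n m * L2_norm_sq P (E_filt P (int n) 0 (S n m))"
  have decomp: "?A D x = ?B D x + ?R x"
    if "martingale_differences_field P D" "square_integrable P (D 1 1)" for D x
    using L2_norm_sq_partial_sum_diff[OF that, of "fst x" "snd x"]
    by (simp add: S case_prod_beta distrib_left)
  \<comment> \<open>These hold for all pairs, including those with a zero side, where every term
    vanishes.\<close>
  have R_le: "?C1 x \<le> ?R x" "?C2 x \<le> ?R x" "?R x \<le> ?C1 x + ?C2 x" for x
    using L2_norm_sq_boundary_part[OF square_integrable_partial_sum, of "int (fst x)" "int (snd x)"]
    by (auto simp: S case_prod_beta simp flip: distrib_left intro!: mult_left_mono)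
  show ?thesis
  proof
    assume "admits_martingale_approximation P X"
    then obtain D where D: "martingale_differences_field P D" and A: "(?A D \<longlongrightarrow> 0) min_to_infinity"
      unfolding admits_martingale_approximation_def by blast
    obtain n m where "1 \<le> n" "1 \<le> m" "?A D (n, m) < \<infinity>"
      using A by (rule tendsto_0_min_to_infinityE)
    then have "square_integrable P (D 1 1)"
      by (intro square_integrable_of_partial_sum_diff[OF D, of n m])
        (auto simp: ennreal_mult_less_top ennreal_zero_less_divide)
    note eq = decomp[OF D this]
    \<comment> \<open>Both are nonnegative summands of \<open>?A D\<close>, so they are squeezed to
      0.\<close>
    have "(?B D \<longlongrightarrow> 0) min_to_infinity" "(?R \<longlongrightarrow> 0) min_to_infinity"
      using A by (rule tendsto_0_le_ennreal; simp only: eq; simp)+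
    then show "(\<exists>D. martingale_differences_field P D \<and> (?B D \<longlongrightarrow> 0) min_to_infinity) \<and>
        (?C1 \<longlongrightarrow> 0) min_to_infinity \<and> (?C2 \<longlongrightarrow> 0) min_to_infinity"
      using D tendsto_0_le_ennreal[of ?R _ ?C1, OF _ R_le(1)]
        tendsto_0_le_ennreal[of ?R _ ?C2, OF _ R_le(2)] by blast
  next
    assume "(\<exists>D. martingale_differences_field P D \<and> (?B D \<longlongrightarrow> 0) min_to_infinity) \<and>
        (?C1 \<longlongrightarrow> 0) min_to_infinity \<and> (?C2 \<longlongrightarrow> 0) min_to_infinity"
    then obtain D where D: "martingale_differences_field P D" and B: "(?B D \<longlongrightarrow> 0) min_to_infinity"
      and C: "(?C1 \<longlongrightarrow> 0) min_to_infinity" "(?C2 \<longlongrightarrow> 0) min_to_infinity"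
      by blast
    obtain n m where nm: "1 \<le> n" "1 \<le> m" "?B D (n, m) < \<infinity>"
      using B by (rule tendsto_0_min_to_infinityE)
    then have "(\<Sum>j = 1..n. \<Sum>k = 1..m. L2_norm_sq P (\<lambda>\<omega>. proj_op P 1 1 (S j k) \<omega> - D 1 1 \<omega>)) < \<infinity>"
      by (auto simp: ennreal_mult_less_top ennreal_zero_less_divide)
    \<comment> \<open>The term \<open>j = k = 1\<close> of a finite sum with nonnegative terms; it
      occurs because \<open>n\<close> and \<open>m\<close> are at least 1.\<close>
    then have "L2_norm_sq P (\<lambda>\<omega>. proj_op P 1 1 (S 1 1) \<omega> - D 1 1 \<omega>) < \<infinity>"
      using nm by simp
    then have "square_integrable P (D 1 1)"
      unfolding S by (rule square_integrable_of_proj_op_diff[OF D])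
    from decomp[OF D this] have eq: "?A D = (\<lambda>x. ?B D x + ?R x)"
      by (rule ext)
    have "((\<lambda>x. ?C1 x + ?C2 x) \<longlongrightarrow> 0) min_to_infinity"
      using tendsto_add[OF C] by simp
    then have "(?R \<longlongrightarrow> 0) min_to_infinity"
      by (rule tendsto_0_le_ennreal[OF _ R_le(3)])
    from tendsto_add[OF B this] have "(?A D \<longlongrightarrow> 0) min_to_infinity"
      unfolding eq by simp
    with D show "admits_martingale_approximation P X"
      unfolding admits_martingale_approximation_def by blast
  qed
qed

end
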